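(* Let $g\in\{3,5\}$ and let $G$ be a minimal $(k,g)$-cage. The distance spectral radius of the subdivision graph $S(G)$ is $$\lambda_1(S(G))=\begin{cases}\frac12\Big[2k^2+\sqrt{2k(2k+1)(k^2+1)}\Big], & g=3,\\[2mm] \frac12\Big[(3k^3+k-2)+\sqrt{9k^6+2k^5+14k^4-40k^3+41k^2-18k+4}\Big], & g=5.\end{cases}$$
   Context: All graphs are finite, simple, connected and undirected. The distance matrix $D(H)$ of a graph $H$ has $(i,j)$ entry equal to the graph distance between the $i$-th and $j$-th vertices; the distance spectral radius $\lambda_1(H)$ of $H$ is the largest eigenvalue of $D(H)$. The subdivision graph $S(G)$ is obtained from $G$ by inserting a new vertex of degree $2$ on each edge of $G$. A $(k,g)$-cage is a $k$-regular simple graph of girth $g$ with the minimum possible number of vertices $n(k,g)$. With $d=\lfloor g/2\rfloor$, one has the lower bound $n(k,g)\ge n_0(k,g)$, where $n_0(k,g)=1+\sum_{i=0}^{d-1}k(k-1)^i$ if $g$ is odd, and $n_0(k,g)=1+\sum_{i=0}^{d-2}k(k-1)^i+(k-1)^{d-1}$ if $g$ is even. A minimal $(k,g)$-cage (Moore graph) is a $(k,g)$-cage with exactly $n_0(k,g)$ vertices; its diameter is $d$. *)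

theory Defs
  imports
    "HOL-Library.Extended_Nat"
    "Graph_Theory.Pair_Digraph"
    "Graph_Theory.Digraph_Component"
    "Graph_Theory.Shortest_Path"
    "Jordan_Normal_Form.Spectral_Radius"
begin

text \<open>
  A finite simple undirected graph is a \<open>pair_graph\<close>: a finite, loop-free, symmetric digraph
  whose arcs are ordered pairs of vertices, so that an edge $uv$ is represented by the two arcs
  $(u,v)$ and $(v,u)$. \<open>Digraph_Component.connected\<close> excludes the null graph; the name is
  qualified because of the topological constant of the same name.
\<close>

definition connected_graph :: "'a pair_pre_digraph \<Rightarrow> bool" where
  "connected_graph G \<longleftrightarrow> pair_graph G \<and> Digraph_Component.connected (with_proj G)"

definition regular :: "nat \<Rightarrow> 'a pair_pre_digraph \<Rightarrow> bool" where
  "regular k G \<longleftrightarrow> (\<forall>v \<in> pverts G. out_degree (with_proj G) v = k)"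

text \<open>
  The library regards the closed walk $u,v,u$ as a cycle of a symmetric digraph; the bound
  \<open>3 \<le> length p\<close> leaves exactly the cycles of the undirected graph. The girth of a forest
  is \<open>\<infinity>\<close>.
\<close>

definition girth :: "'a pair_pre_digraph \<Rightarrow> enat" where
  "girth G = (INF p \<in> {p. pre_digraph.cycle (with_proj G) p \<and> 3 \<le> length p}. enat (length p))"

definition regular_girth_graph :: "nat \<Rightarrow> nat \<Rightarrow> 'a pair_pre_digraph \<Rightarrow> bool" where
  "regular_girth_graph k g G \<longleftrightarrow> connected_graph G \<and> regular k G \<and> girth G = enat g"

text \<open>
  The number $n(k,g)$. Every finite graph is isomorphic to one whose vertices are natural
  numbers, so the minimum may be taken over graphs of this kind.
\<close>

definition cage_order :: "nat \<Rightarrow> nat \<Rightarrow> nat" where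
  "cage_order k g =
     (LEAST n. \<exists>H :: nat pair_pre_digraph. regular_girth_graph k g H \<and> card (pverts H) = n)"

definition cage :: "nat \<Rightarrow> nat \<Rightarrow> 'a pair_pre_digraph \<Rightarrow> bool" where
  "cage k g G \<longleftrightarrow> regular_girth_graph k g G \<and> card (pverts G) = cage_order k g"

text \<open>
  The lower bound $n_0(k,g)$, for $g \ge 3$ and $k \ge 1$; the truncated subtractions are then
  genuine ones.
\<close>

definition moore_bound :: "nat \<Rightarrow> nat \<Rightarrow> nat" where
  "moore_bound k g =
     (let d = g div 2 in
      if odd g then 1 + (\<Sum>i<d. k * (k - 1) ^ i)
      else 1 + (\<Sum>i<d - 1. k * (k - 1) ^ i) + (k - 1) ^ (d - 1))"

definition minimal_cage :: "nat \<Rightarrow> nat \<Rightarrow> 'a pair_pre_digraph \<Rightarrow> bool" where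
  "minimal_cage k g G \<longleftrightarrow> cage k g G \<and> card (pverts G) = moore_bound k g"

text \<open>
  In the subdivision graph, \<open>Inl v\<close> is an old vertex and \<open>Inr {u, v}\<close> is the vertex inserted
  on the edge $uv$. The arcs $(u,v)$ and $(v,u)$ of $G$ yield the same inserted vertex.
\<close>

definition edge_set :: "'a pair_pre_digraph \<Rightarrow> 'a set set" where
  "edge_set G = {{u, v} | u v. (u, v) \<in> parcs G}"

definition subdivision_graph :: "'a pair_pre_digraph \<Rightarrow> ('a + 'a set) pair_pre_digraph" where
  "subdivision_graph G =
     \<lparr> pverts = Inl ` pverts G \<union> Inr ` edge_set G,
       parcs = {(Inl v, Inr e) | v e. e \<in> edge_set G \<and> v \<in> e}
             \<union> {(Inr e, Inl v) | v e. e \<in> edge_set G \<and> v \<in> e} \<rparr>"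

text \<open>
  Graph distance is the library's shortest-path distance with all arcs of weight 1. It is
  finite in a connected graph, so that \<open>real_of_ereal\<close> loses nothing there.
\<close>

definition graph_dist :: "'a pair_pre_digraph \<Rightarrow> 'a \<Rightarrow> 'a \<Rightarrow> real" where
  "graph_dist G u v = real_of_ereal (wf_digraph.\<mu> (with_proj G) (\<lambda>_. 1) u v)"

text \<open>
  The list \<open>vs\<close> fixes the numbering of the vertices that is implicit in the phrase
  ``the $i$-th vertex''.
\<close>

definition vertex_ordering :: "'a pair_pre_digraph \<Rightarrow> 'a list \<Rightarrow> bool" where
  "vertex_ordering G vs \<longleftrightarrow> distinct vs \<and> set vs = pverts G"

definition distance_matrix :: "'a pair_pre_digraph \<Rightarrow> 'a list \<Rightarrow> real mat" where
  "distance_matrix G vs =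
     mat (length vs) (length vs) (\<lambda>(i, j). graph_dist G (vs ! i) (vs ! j))"

text \<open>
  The spectrum of a real matrix consists of its real eigenvalues; the distance matrix is
  symmetric, so these are all of its eigenvalues.
\<close>

definition distance_spectral_radius :: "'a pair_pre_digraph \<Rightarrow> 'a list \<Rightarrow> real" where
  "distance_spectral_radius G vs = Max (spectrum (distance_matrix G vs))"

end

theory Submission
  imports Defs
begin

text \<open>
  Partition the vertices of \<open>S(G)\<close> into old and inserted ones. In a Moore graph of diameter at most
  two the number of vertices and of edges at each distance from a fixed vertex, or from a fixed edge,
  does not depend on that vertex or edge, so the four blocks of the distance matrix of \<open>S(G)\<close> have
  constant row sums $a$, $b$, $c$, $d$. The larger root of the characteristic polynomial of the
  $2 \times 2$ quotient matrix then has an eigenvector constant on both parts with positive entries,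
  and an eigenvalue of a nonnegative matrix with a positive eigenvector is the largest one.

  The counts need no case distinction between the two girths: a distance at most two is two minus the
  number of radii $0, 1$ whose ball is met, so everything reduces to the number of vertices in, and
  of edges touching, the balls of radius $0$ and $1$. Since $G$ is $k$-regular, the number of edges
  touching $T$ is $k|T|$ minus the number of edges inside $T$.
\<close>

section \<open>Matrices with a positive eigenvector\<close>

text \<open>An arbitrary eigenvector \<open>w\<close> for \<open>s\<close> is compared with the
  positive \<open>x\<close> at an index where |w_i| / x_i is largest. There nonnegativity of
  \<open>A\<close> and the triangle inequality bound s |w_i| by r |w_i|.\<close>

lemma Max_spectrum_positive_eigenvector:
  fixes A :: "real mat"
  assumes A: "A \<in> carrier_mat n n" and n: "n > 0"
    and nonneg: "\<And>i j. i < n \<Longrightarrow> j < n \<Longrightarrow> A $$ (i, j) \<ge> 0"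
    and pos: "\<And>i. i < n \<Longrightarrow> x i > 0"
    and eigen: "\<And>i. i < n \<Longrightarrow> (\<Sum>j<n. A $$ (i, j) * x j) = r * x i"
  shows "Max (spectrum A) = r"
proof (rule Max_eqI)
  show "finite (spectrum A)" using card_finite_spectrum[OF A] by simp
  have "eigenvector A (vec n x) r"
    unfolding eigenvector_def
  proof (intro conjI)
    show "vec n x \<in> carrier_vec (dim_row A)" using A by simp
    show "vec n x \<noteq> 0\<^sub>v (dim_row A)"
    proof
      assume "vec n x = 0\<^sub>v (dim_row A)"
      then have "vec n x $ 0 = 0\<^sub>v (dim_row A) $ 0" by simp
      then show False using A n pos[of 0] by simp
    qed
    show "A *\<^sub>v vec n x = r \<cdot>\<^sub>v vec n x"
      using A eigen by (auto intro!: eq_vecI simp: scalar_prod_def lessThan_atLeast0)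
  qed
  then show "r \<in> spectrum A" by (auto simp: spectrum_def eigenvalue_def)
next
  fix s assume "s \<in> spectrum A"
  then obtain w where w: "w \<in> carrier_vec n" "w \<noteq> 0\<^sub>v n" "A *\<^sub>v w = s \<cdot>\<^sub>v w"
    using A by (auto simp: spectrum_def eigenvalue_def eigenvector_def)
  \<comment> \<open>The least \<open>c\<close> with |w| \<le> c x componentwise; the index
    \<open>i\<close> attaining it gives equality.\<close>
  define c where "c = Max ((\<lambda>i. \<bar>w $ i\<bar> / x i) ` {..<n})"
  have "c \<in> (\<lambda>i. \<bar>w $ i\<bar> / x i) ` {..<n}"
    unfolding c_def using n by (intro Max_in) auto
  then obtain i where i: "i < n" "c = \<bar>w $ i\<bar> / x i" by auto
  have le: "\<bar>w $ j\<bar> \<le> c * x j" if "j < n" for j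
  proof -
    have "\<bar>w $ j\<bar> / x j \<le> c" unfolding c_def using that by (intro Max_ge) auto
    then show ?thesis using pos[OF that] by (simp add: field_simps)
  qed
  \<comment> \<open>A nonzero entry of \<open>w\<close> forces c > 0, hence w_i \<noteq> 0 at the
    maximising index, which permits the final cancellation.\<close>
  obtain j where j: "j < n" "w $ j \<noteq> 0"
    using w(1,2) by (metis carrier_vecD eq_vecI index_zero_vec)
  then have "c * x j > 0" using le[OF j(1)] by linarith
  then have c: "c > 0" using pos[OF j(1)] by (simp add: zero_less_mult_iff)
  have "(A *\<^sub>v w) $ i = (s \<cdot>\<^sub>v w) $ i" using w(3) by simp
  then have eq: "s * w $ i = (\<Sum>j<n. A $$ (i, j) * w $ j)"
    using A w(1) i(1) by (simp add: scalar_prod_def lessThan_atLeast0)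
  have "s * \<bar>w $ i\<bar> \<le> \<bar>s * w $ i\<bar>" by (simp add: abs_mult mult_right_mono)
  also have "\<dots> \<le> (\<Sum>j<n. \<bar>A $$ (i, j) * w $ j\<bar>)" unfolding eq by (rule sum_abs)
  also have "\<dots> = (\<Sum>j<n. A $$ (i, j) * \<bar>w $ j\<bar>)"
    using nonneg i(1) by (intro sum.cong) (auto simp: abs_mult)
  also have "\<dots> \<le> (\<Sum>j<n. A $$ (i, j) * (c * x j))"
    using nonneg i(1) le by (intro sum_mono mult_left_mono) auto
  also have "\<dots> = c * (\<Sum>j<n. A $$ (i, j) * x j)"
    by (simp add: sum_distrib_left algebra_simps)
  also have "\<dots> = r * (c * x i)" using eigen[OF i(1)] by simp
  also have "c * x i = \<bar>w $ i\<bar>" using i pos[OF i(1)] by simp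
  finally have "s * \<bar>w $ i\<bar> \<le> r * \<bar>w $ i\<bar>" .
  moreover have "\<bar>w $ i\<bar> > 0" using i c pos[OF i(1)] by (auto simp: zero_less_divide_iff)
  ultimately show "s \<le> r" by simp
qed

text \<open>Here \<open>r\<close> is the larger root of t^2 - (a + d) t + (a d - b c). The vector
  (b, r - a) satisfies the first row of the quotient matrix identically; the second row is the
  displayed equation, a rearrangement of the characteristic equation.\<close>

lemma two_by_two_Perron_root:
  fixes a b c d :: real
  assumes "b > 0" "c > 0"
  defines "r \<equiv> 1 / 2 * (a + d + sqrt ((a - d) ^ 2 + 4 * b * c))"
  shows "r > a" and "c * b + d * (r - a) = r * (r - a)"
proof -
  have disc: "(a - d) ^ 2 < (a - d) ^ 2 + 4 * b * c" using assms by simp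
  \<comment> \<open>The left side is |a - d|, so 2 r > a + d + |a - d| \<ge> 2 a.\<close>
  then have "sqrt ((a - d) ^ 2) < sqrt ((a - d) ^ 2 + 4 * b * c)" by (rule real_sqrt_less_mono)
  then show "r > a" by (simp add: r_def)
  have "sqrt ((a - d) ^ 2 + 4 * b * c) ^ 2 = (a - d) ^ 2 + 4 * b * c"
    using disc zero_le_power2[of "a - d"] by (intro real_sqrt_pow2) linarith
  moreover have "sqrt ((a - d) ^ 2 + 4 * b * c) = 2 * r - a - d" unfolding r_def
    by (simp add: field_simps)
  ultimately have "(2 * r - a - d) ^ 2 = (a - d) ^ 2 + 4 * b * c" by simp
  then show "c * b + d * (r - a) = r * (r - a)" by (simp add: power2_eq_square algebra_simps)
qed

lemma distance_spectral_radius_equitable: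
  fixes H :: "('a + 'b) pair_pre_digraph"
  assumes ord: "vertex_ordering H vs" and H: "pverts H = Inl ` V \<union> Inr ` E"
    and fin: "finite V" "finite E" and V: "V \<noteq> {}"
    and nonneg: "\<And>x y. x \<in> pverts H \<Longrightarrow> y \<in> pverts H \<Longrightarrow> graph_dist H x y \<ge> 0"
    and a: "\<And>u. u \<in> V \<Longrightarrow> (\<Sum>v\<in>V. graph_dist H (Inl u) (Inl v)) = a"
    and b: "\<And>u. u \<in> V \<Longrightarrow> (\<Sum>f\<in>E. graph_dist H (Inl u) (Inr f)) = b"
    and c: "\<And>e. e \<in> E \<Longrightarrow> (\<Sum>v\<in>V. graph_dist H (Inr e) (Inl v)) = c"
    and d: "\<And>e. e \<in> E \<Longrightarrow> (\<Sum>f\<in>E. graph_dist H (Inr e) (Inr f)) = d"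
    and pos: "b > 0" "c > 0"
  shows "distance_spectral_radius H vs = 1 / 2 * (a + d + sqrt ((a - d) ^ 2 + 4 * b * c))"
proof -
  define r where "r = 1 / 2 * (a + d + sqrt ((a - d) ^ 2 + 4 * b * c))"
  note root = two_by_two_Perron_root[OF pos, where a = a and d = d, folded r_def]
  define n where "n = length vs"
  \<comment> \<open>The eigenvector (b, r - a) of the quotient matrix, spread constantly over the
    two parts.\<close>
  define z where "z = case_sum (\<lambda>_ :: 'a. b) (\<lambda>_ :: 'b. r - a)"
  have vs: "distinct vs" "set vs = pverts H" using ord by (auto simp: vertex_ordering_def)
  have "pverts H \<noteq> {}" using V H by blast
  then have "n > 0" unfolding n_def vs(2)[symmetric] by simp
  have in_H: "vs ! i \<in> pverts H" if "i < n" for i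
    using that vs(2) nth_mem unfolding n_def by blast
  have z_pos: "z x > 0" for x
    using root(1) pos by (auto simp: z_def split: sum.split)
  have eigen: "(\<Sum>y\<in>pverts H. graph_dist H x y * z y) = r * z x" if "x \<in> pverts H" for x
  proof -
    have "(\<Sum>y\<in>pverts H. graph_dist H x y * z y) =
        (\<Sum>v\<in>V. graph_dist H x (Inl v) * z (Inl v)) + (\<Sum>f\<in>E. graph_dist H x (Inr f) * z (Inr f))"
      unfolding H using fin by (subst sum.union_disjoint) (auto simp: sum.reindex inj_on_def)
    also have "\<dots> = (\<Sum>v\<in>V. graph_dist H x (Inl v)) * b + (\<Sum>f\<in>E. graph_dist H x (Inr f)) * (r - a)"
      by (simp add: z_def sum_distrib_right)
    finally have eq: "(\<Sum>y\<in>pverts H. graph_dist H x y * z y) = \<dots>" .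
    show ?thesis
    proof (cases x)
      case (Inl u)
      then have "u \<in> V" using that H by auto
      then show ?thesis unfolding eq using Inl by (simp add: a b z_def algebra_simps)
    next
      case (Inr e)
      then have "e \<in> E" using that H by auto
      then show ?thesis unfolding eq
        using Inr root(2) by (simp add: c d z_def)
    qed
  qed
  have bij: "bij_betw ((!) vs) {..<n} (pverts H)"
    using vs by (intro bij_betw_nth) (auto simp: n_def)
  show ?thesis
    unfolding distance_spectral_radius_def r_def[symmetric]
  proof (rule Max_spectrum_positive_eigenvector[where n = n and x = "\<lambda>i. z (vs ! i)"])
    show "distance_matrix H vs \<in> carrier_mat n n" by (simp add: distance_matrix_def n_def)
    fix i assume i: "i < n"
    show "distance_matrix H vs $$ (i, j) \<ge> 0" if "j < n" for j
      using i that nonneg in_H by (simp add: distance_matrix_def n_def)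
    have "(\<Sum>j<n. distance_matrix H vs $$ (i, j) * z (vs ! j)) =
        (\<Sum>j<n. graph_dist H (vs ! i) (vs ! j) * z (vs ! j))"
      using i by (intro sum.cong) (auto simp: distance_matrix_def n_def)
    also have "\<dots> = (\<Sum>y\<in>pverts H. graph_dist H (vs ! i) y * z y)"
      by (rule sum.reindex_bij_betw[OF bij])
    also have "\<dots> = r * z (vs ! i)" using eigen[OF in_H[OF i]] .
    finally show "(\<Sum>j<n. distance_matrix H vs $$ (i, j) * z (vs ! j)) = r * z (vs ! i)" .
  qed (use \<open>n > 0\<close> z_pos in auto)
qed

section \<open>Distances in the subdivision graph\<close>

text \<open>
  Such a function is the distance from \<open>S\<close>; checking these local conditions avoids handling walks in
  the subdivision graph.
\<close>

definition distance_to :: "'a pair_pre_digraph \<Rightarrow> 'a set \<Rightarrow> ('a \<Rightarrow> nat) \<Rightarrow> bool" where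
  "distance_to G S f \<longleftrightarrow> (\<forall>s\<in>S. f s = 0) \<and> (\<forall>(x, y)\<in>parcs G. f y \<le> f x + 1) \<and>
     (\<forall>y\<in>pverts G - S. \<exists>x. (x, y) \<in> parcs G \<and> f y = f x + 1)"

text \<open>Since \<open>f\<close> grows by at most one along an arc, a walk from \<open>u\<close>
  to \<open>v\<close> has length at least \<open>f v\<close>. Descending along predecessors of
  smaller value yields a walk of exactly that length.\<close>

lemma graph_dist_eqI:
  assumes "pair_wf_digraph G" and f: "distance_to G {u} f" and u: "u \<in> pverts G" and v: "v \<in> pverts G"
  shows "graph_dist G u v = real (f v)"
proof -
  interpret pair_wf_digraph G by fact
  have cost: "awalk_cost (\<lambda>_. 1) p = real (length p)" for p :: "('a \<times> 'a) list"
    by (simp add: awalk_cost_def sum_list_triv)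
  have lower: "f y \<le> f x + length p" if "awalk x p y" for x p y
    using that
  proof (induct p arbitrary: x)
    case Nil then show ?case by (simp add: awalk_Nil_iff)
  next
    case (Cons e p)
    then have "f y \<le> f (snd e) + length p" "e \<in> parcs G" "fst e = x" by (auto simp: awalk_Cons_iff)
    moreover have "f (snd e) \<le> f (fst e) + 1"
      using f \<open>e \<in> parcs G\<close> by (auto simp: distance_to_def split: prod.splits)
    ultimately show ?case by simp
  qed
  have upper: "\<exists>p. awalk u p y \<and> length p = f y" if "y \<in> pverts G" for y
    using that
  proof (induct "f y" arbitrary: y rule: less_induct)
    case less
    show ?case
    proof (cases "y = u")
      case True
      then show ?thesis using f less.prems
        by (intro exI[of _ "[]"]) (simp add: awalk_Nil_iff distance_to_def)
    next
      case False
      then obtain x where x: "(x, y) \<in> parcs G" "f y = f x + 1"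
        using f less.prems by (auto simp: distance_to_def)
      then obtain p where p: "awalk u p x" "length p = f x"
        using less.hyps[of x] in_arcsD1 by auto
      have "awalk x [(x, y)] y" using x(1) in_arcsD1 in_arcsD2 by (auto simp: awalk_simps)
      then have "awalk u (p @ [(x, y)]) y" using p(1) by (rule awalk_appendI[rotated])
      then show ?thesis using p(2) x(2) by (intro exI[of _ "p @ [(x, y)]"]) simp
    qed
  qed
  have "\<mu> (\<lambda>_. 1) u v = ereal (real (f v))"
    unfolding \<mu>_def
  proof (rule antisym)
    obtain p where "awalk u p v" "length p = f v" using upper[OF v] by auto
    then show "(INF p\<in>{p. awalk u p v}. ereal (awalk_cost (\<lambda>_. 1) p)) \<le> ereal (real (f v))"
      by (intro INF_lower2[of p]) (auto simp: cost)
    have "f u = 0" using f by (simp add: distance_to_def)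
    then show "ereal (real (f v)) \<le> (INF p\<in>{p. awalk u p v}. ereal (awalk_cost (\<lambda>_. 1) p))"
      using lower by (intro INF_greatest) (fastforce simp: cost)
  qed
  then show ?thesis by (simp add: graph_dist_def)
qed

section \<open>Edges of a graph and arcs of its subdivision\<close>

lemma edge_set_iff:
  assumes "pair_graph G"
  shows "{x, y} \<in> edge_set G \<longleftrightarrow> (x, y) \<in> parcs G"
proof -
  interpret pair_graph G by fact
  show ?thesis by (auto simp: edge_set_def doubleton_eq_iff dest: arcs_symmetric)
qed

lemma edge_setE:
  assumes "pair_graph G" "e \<in> edge_set G" "x \<in> e"
  obtains y where "e = {x, y}" "(x, y) \<in> parcs G" "x \<in> pverts G" "y \<in> pverts G" "x \<noteq> y"
proof -
  interpret pair_graph G by fact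
  obtain u v where "e = {u, v}" "(u, v) \<in> parcs G" using assms(2) by (auto simp: edge_set_def)
  then show ?thesis
    using assms(3) that[of u] that[of v] arcs_symmetric in_arcsD1 in_arcsD2 no_loops'
    by (metis insert_commute insert_iff singletonD)
qed

lemma finite_edge_set:
  assumes "pair_graph G"
  shows "finite (edge_set G)"
proof -
  interpret pair_graph G by fact
  have "edge_set G = (\<lambda>(x, y). {x, y}) ` parcs G" by (auto simp: edge_set_def)
  then show ?thesis using pair_finite_arcs by simp
qed

lemma parcs_subdivision_graph_iff:
  "(x, y) \<in> parcs (subdivision_graph G) \<longleftrightarrow>
    (\<exists>v e. e \<in> edge_set G \<and> v \<in> e \<and> (x = Inl v \<and> y = Inr e \<or> x = Inr e \<and> y = Inl v))"
  by (auto simp: subdivision_graph_def)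

lemma pverts_subdivision_graph:
  "pverts (subdivision_graph G) = Inl ` pverts G \<union> Inr ` edge_set G"
  by (simp add: subdivision_graph_def)

lemma pair_wf_digraph_subdivision_graph:
  assumes "pair_graph G"
  shows "pair_wf_digraph (subdivision_graph G)"
proof
  fix a assume "a \<in> parcs (subdivision_graph G)"
  then obtain v e where ve: "e \<in> edge_set G" "v \<in> e" "a = (Inl v, Inr e) \<or> a = (Inr e, Inl v)"
    by (cases a) (auto simp: parcs_subdivision_graph_iff)
  moreover have "v \<in> pverts G" using edge_setE[OF assms ve(1,2)] .
  ultimately show "fst a \<in> pverts (subdivision_graph G)" "snd a \<in> pverts (subdivision_graph G)"
    by (auto simp: pverts_subdivision_graph)
qed

text \<open>Both arcs of an edge are present, so the one-sided bound on \<open>f\<close> makes its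
  values at the two ends differ by at most one. The minimum over an edge serves as the distance to
  its nearer end.\<close>

lemma edge_Min:
  fixes f :: "'a \<Rightarrow> nat"
  assumes G: "pair_graph G" and e: "e \<in> edge_set G"
    and lip: "\<And>x y. (x, y) \<in> parcs G \<Longrightarrow> f y \<le> f x + 1"
  shows "\<exists>v\<in>e. Min (f ` e) = f v"
    and "v \<in> e \<Longrightarrow> Min (f ` e) \<le> f v"
    and "v \<in> e \<Longrightarrow> f v \<le> Min (f ` e) + 1"
proof -
  obtain u w where e': "e = {u, w}" "(u, w) \<in> parcs G" using e by (auto simp: edge_set_def)
  then have "(w, u) \<in> parcs G" using G e by (metis edge_set_iff insert_commute)
  then have "f u \<le> f w + 1" "f w \<le> f u + 1" using e' lip by auto
  then show "\<exists>v\<in>e. Min (f ` e) = f v" "v \<in> e \<Longrightarrow> Min (f ` e) \<le> f v"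
    "v \<in> e \<Longrightarrow> f v \<le> Min (f ` e) + 1" using e' by (auto simp: min_def)
qed

text \<open>Each edge becomes a path of length two, so distances between old vertices double, and an
  inserted vertex lies one step beyond the nearer end of its edge.\<close>

lemma distance_to_subdivision_vertex:
  assumes G: "pair_graph G" and f: "distance_to G {u} f"
  shows "distance_to (subdivision_graph G) {Inl u}
    (case_sum (\<lambda>v. 2 * f v) (\<lambda>e. 1 + 2 * Min (f ` e)))" (is "distance_to ?S _ ?g")
proof -
  have lip: "f y \<le> f x + 1" if "(x, y) \<in> parcs G" for x y
    using f that by (auto simp: distance_to_def)
  note Min = edge_Min[where f = f, OF G _ lip]
  show ?thesis
    unfolding distance_to_def
  proof (intro conjI ballI)
    show "?g s = 0" if "s \<in> {Inl u}" for s using f that by (simp add: distance_to_def)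
    show "case a of (x, y) \<Rightarrow> ?g y \<le> ?g x + 1" if "a \<in> parcs ?S" for a
      using that Min(2,3) by (cases a) (fastforce simp: parcs_subdivision_graph_iff)
    fix y assume y: "y \<in> pverts ?S - {Inl u}"
    show "\<exists>x. (x, y) \<in> parcs ?S \<and> ?g y = ?g x + 1"
    proof (cases y)
      case (Inl v)
      \<comment> \<open>The midpoint of \<open>{w, v}\<close> is the predecessor: its value is 1 + 2
        f(w), since \<open>w\<close> is the nearer end.\<close>
      then obtain w where w: "(w, v) \<in> parcs G" "f v = f w + 1"
        using f y by (auto simp: distance_to_def pverts_subdivision_graph)
      then have "{w, v} \<in> edge_set G" using edge_set_iff[OF G] by auto
      then have "(Inr {w, v}, y) \<in> parcs ?S" using Inl by (auto simp: parcs_subdivision_graph_iff)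
      then show ?thesis using Inl w by (intro exI[of _ "Inr {w, v}"]) simp
    next
      case (Inr e)
      then have "e \<in> edge_set G" using y by (auto simp: pverts_subdivision_graph)
      moreover obtain v where "v \<in> e" "Min (f ` e) = f v" using Min(1) calculation by blast
      ultimately show ?thesis
        using Inr by (intro exI[of _ "Inl v"]) (auto simp: parcs_subdivision_graph_iff)
    qed
  qed
qed

text \<open>One step leads from the inserted vertex to either end of \<open>e\<close>; from there
  on, distances to the two-element set \<open>e\<close> are doubled. The generic formula would give
  2 at \<open>e\<close> itself, hence the separate value 0.\<close>

lemma distance_to_subdivision_edge:
  assumes G: "pair_graph G" and e: "e \<in> edge_set G" and f: "distance_to G e f"
  shows "distance_to (subdivision_graph G) {Inr e}
    (case_sum (\<lambda>v. 1 + 2 * f v) (\<lambda>e'. if e' = e then 0 else 2 + 2 * Min (f ` e')))"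
    (is "distance_to ?S _ ?g")
proof -
  have lip: "f y \<le> f x + 1" if "(x, y) \<in> parcs G" for x y
    using f that by (auto simp: distance_to_def)
  have zero: "f x = 0" if "x \<in> e" for x using f that by (auto simp: distance_to_def)
  note Min = edge_Min[where f = f, OF G _ lip]
  show ?thesis
    unfolding distance_to_def
  proof (intro conjI ballI)
    show "?g s = 0" if "s \<in> {Inr e}" for s using that by simp
    show "case a of (x, y) \<Rightarrow> ?g y \<le> ?g x + 1" if "a \<in> parcs ?S" for a
      using that Min(2,3) zero by (cases a) (fastforce simp: parcs_subdivision_graph_iff)
    fix y assume y: "y \<in> pverts ?S - {Inr e}"
    show "\<exists>x. (x, y) \<in> parcs ?S \<and> ?g y = ?g x + 1"
    proof (cases y)
      case (Inl v)
      show ?thesis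
      proof (cases "v \<in> e")
        case True
        then show ?thesis using Inl e zero
          by (intro exI[of _ "Inr e"]) (auto simp: parcs_subdivision_graph_iff)
      next
        case False
        then have "v \<in> pverts G - e" using Inl y by (auto simp: pverts_subdivision_graph)
        then obtain w where w: "(w, v) \<in> parcs G" "f v = f w + 1"
          using f unfolding distance_to_def by blast
        then have "{w, v} \<in> edge_set G" using edge_set_iff[OF G] by auto
        then have "(Inr {w, v}, y) \<in> parcs ?S" using Inl by (auto simp: parcs_subdivision_graph_iff)
        \<comment> \<open>The predecessor must not be the exceptional vertex
          \<open>e\<close>.\<close>
        moreover have "{w, v} \<noteq> e" using False by auto
        ultimately show ?thesis using Inl w by (intro exI[of _ "Inr {w, v}"]) simp
      qed
    next
      case (Inr e')
      then have "e' \<in> edge_set G" "e' \<noteq> e" using y by (auto simp: pverts_subdivision_graph)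
      moreover obtain v where "v \<in> e'" "Min (f ` e') = f v" using Min(1) calculation by blast
      ultimately show ?thesis
        using Inr by (intro exI[of _ "Inl v"]) (auto simp: parcs_subdivision_graph_iff)
    qed
  qed
qed

section \<open>Row sums for regular graphs of diameter two\<close>

locale regular_pair_graph = pair_graph G for G :: "'a pair_pre_digraph" and k :: nat +
  assumes regular: "regular k G"
begin

definition nbrs :: "'a \<Rightarrow> 'a set" where
  "nbrs v = {x. (v, x) \<in> parcs G}"

text \<open>The closed neighbourhood of a set, so that vertices and edges can both serve as
  centres.\<close>

definition ball :: "'a set \<Rightarrow> 'a set" where
  "ball T = T \<union> (\<Union>v\<in>T. nbrs v)"

definition edges_touching :: "'a set \<Rightarrow> 'a set set" where
  "edges_touching T = {e \<in> edge_set G. e \<inter> T \<noteq> {}}"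

definition edges_within :: "'a set \<Rightarrow> 'a set set" where
  "edges_within T = {e \<in> edge_set G. e \<subseteq> T}"

text \<open>The distance from \<open>T\<close> cut off at two; the default 2 is the true distance
  once the diameter is at most two.\<close>

definition layer :: "'a set \<Rightarrow> 'a \<Rightarrow> nat" where
  "layer T v = (if v \<in> T then 0 else if v \<in> ball T then 1 else 2)"

section \<open>Neighbourhoods and edge counts in a regular graph\<close>

lemma nbrs_iff: "x \<in> nbrs v \<longleftrightarrow> (v, x) \<in> parcs G"
  by (simp add: nbrs_def)

lemma nbrs_sym: "x \<in> nbrs v \<longleftrightarrow> v \<in> nbrs x"
  using arcs_symmetric by (auto simp: nbrs_iff)

lemma not_in_nbrs: "v \<notin> nbrs v"
  using no_loops' by (auto simp: nbrs_iff)

lemma nbrs_subset: "nbrs v \<subseteq> pverts G"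
  using in_arcsD2 by (auto simp: nbrs_iff)

lemma finite_nbrs: "finite (nbrs v)"
  using nbrs_subset pair_finite_verts by (rule finite_subset)

lemma ball_subset: "T \<subseteq> pverts G \<Longrightarrow> ball T \<subseteq> pverts G"
  using nbrs_subset by (auto simp: ball_def)

lemma card_nbrs:
  assumes "v \<in> pverts G"
  shows "card (nbrs v) = k"
proof -
  have "out_arcs (with_proj G) v = Pair v ` nbrs v" by (auto simp: out_arcs_def nbrs_iff)
  then have "out_degree (with_proj G) v = card (nbrs v)"
    by (simp add: out_degree_def card_image inj_on_def)
  then show ?thesis using regular assms by (simp add: regular_def)
qed

lemma card_incident_edges:
  assumes "v \<in> pverts G"
  shows "card {e \<in> edge_set G. v \<in> e} = k"
proof -
  have "{e \<in> edge_set G. v \<in> e} = (\<lambda>x. {v, x}) ` nbrs v"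
    by (auto simp: edge_set_iff[OF pair_graph] nbrs_iff elim: edge_setE[OF pair_graph])
  moreover have "inj_on (\<lambda>x. {v, x}) (nbrs v)" by (auto simp: inj_on_def doubleton_eq_iff)
  ultimately show ?thesis using card_nbrs[OF assms] by (simp add: card_image)
qed

text \<open>Double counting of incidences between \<open>T\<close> and the edges: an edge with two
  ends in \<open>T\<close> is counted both as touching and as within, and each vertex of
  \<open>T\<close> lies on \<open>k\<close> edges.\<close>

lemma edges_touching_within:
  assumes "T \<subseteq> pverts G"
  shows "card (edges_touching T) + card (edges_within T) = k * card T"
proof -
  have fin: "finite (edge_set G)" "finite T"
    using finite_edge_set[OF pair_graph] finite_subset[OF assms pair_finite_verts] by auto
  have card_Int: "(if e \<inter> T \<noteq> {} then 1 else 0) + (if e \<subseteq> T then 1 else 0) = card (e \<inter> T)"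
    if e: "e \<in> edge_set G" for e
  proof -
    obtain x y where "e = {x, y}" "(x, y) \<in> parcs G" using e by (auto simp: edge_set_def)
    then show ?thesis using no_loops' by (auto simp: Int_insert_left)
  qed
  have "card (edges_touching T) + card (edges_within T) = (\<Sum>e\<in>edge_set G. card (e \<inter> T))"
    using fin card_Int
    by (simp add: edges_touching_def edges_within_def card_eq_sum sum.inter_filter sum.distrib[symmetric]
        del: sum_constant One_nat_def)
  also have "\<dots> = (\<Sum>e\<in>edge_set G. \<Sum>v\<in>T. if v \<in> e then 1 else 0)"
    using fin by (simp add: sum.inter_filter[symmetric] card_eq_sum Int_def conj_commute
        del: sum_constant One_nat_def)
  also have "\<dots> = (\<Sum>v\<in>T. \<Sum>e\<in>edge_set G. if v \<in> e then 1 else 0)" by (rule sum.swap)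
  also have "\<dots> = (\<Sum>v\<in>T. card {e \<in> edge_set G. v \<in> e})"
    using fin by (simp add: sum.inter_filter[symmetric] card_eq_sum del: sum_constant One_nat_def)
  also have "\<dots> = k * card T"
    using assms by (subst sum.cong[OF refl card_incident_edges]) auto
  finally show ?thesis .
qed

lemma edges_touching_pverts: "edges_touching (pverts G) = edge_set G"
  using in_arcsD1 in_arcsD2 by (auto simp: edges_touching_def edge_set_def)

lemma card_edge_set: "2 * card (edge_set G) = k * card (pverts G)"
proof -
  have "edges_within (pverts G) = edge_set G"
    using in_arcsD1 in_arcsD2 by (auto simp: edges_within_def edge_set_def)
  then show ?thesis using edges_touching_within[of "pverts G"] edges_touching_pverts by simp
qed

lemma card_edges_touching_vertex:
  assumes "u \<in> pverts G"
  shows "card (edges_touching {u}) = k"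
  using card_incident_edges[OF assms] by (simp add: edges_touching_def)

lemma card_edge:
  assumes "e \<in> edge_set G"
  shows "card e = 2"
  using assms no_loops' by (auto simp: edge_set_def)

lemma edge_subset: "e \<in> edge_set G \<Longrightarrow> e \<subseteq> pverts G"
  using in_arcsD1 in_arcsD2 by (auto simp: edge_set_def)

text \<open>The only edge contained in \<open>e\<close> is \<open>e\<close> itself. The additive
  form avoids truncated subtraction.\<close>

lemma card_edges_touching_edge:
  assumes e: "e \<in> edge_set G"
  shows "card (edges_touching e) + 1 = 2 * k"
proof -
  have "f = e" if "f \<in> edge_set G" "f \<subseteq> e" for f
    using that card_edge[OF e] card_edge[of f]
      by (metis card.infinite card_subset_eq zero_neq_numeral)
  then have "edges_within e = {e}" using e by (auto simp: edges_within_def)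
  then show ?thesis using edges_touching_within[OF edge_subset[OF e]] card_edge[OF e] by simp
qed

text \<open>Pointwise, \<open>layer T v\<close> is 2 minus the indicators of \<open>T\<close> and
  \<open>ball T\<close>, because T \<subseteq> ball T.\<close>

lemma sum_layer:
  assumes "T \<subseteq> pverts G"
  shows "(\<Sum>v\<in>pverts G. layer T v) + card T + card (ball T) = 2 * card (pverts G)"
proof -
  note fin = pair_finite_verts
  have card: "card A = (\<Sum>v\<in>pverts G. if v \<in> A then 1 else 0)" if "A \<subseteq> pverts G" for A
  proof -
    have "{v \<in> pverts G. v \<in> A} = A" using that by auto
    then show ?thesis using fin by (simp add: sum.inter_filter[symmetric])
  qed
  have "card T = (\<Sum>v\<in>pverts G. if v \<in> T then 1 else 0)"
    "card (ball T) = (\<Sum>v\<in>pverts G. if v \<in> ball T then 1 else 0)"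
    using assms ball_subset card by auto
  then have "(\<Sum>v\<in>pverts G. layer T v) + card T + card (ball T) =
      (\<Sum>v\<in>pverts G. layer T v + (if v \<in> T then 1 else 0) + (if v \<in> ball T then 1 else 0))"
    by (simp add: sum.distrib)
  also have "\<dots> = (\<Sum>v\<in>pverts G. 2)"
    by (rule sum.cong) (auto simp: layer_def ball_def)
  finally show ?thesis by simp
qed

text \<open>The minimum over an edge drops from 2 by one for each of \<open>T\<close> and
  \<open>ball T\<close> that the edge meets.\<close>

lemma sum_Min_layer:
  "(\<Sum>e\<in>edge_set G. Min (layer T ` e)) + card (edges_touching T) + card (edges_touching (ball T)) =
    2 * card (edge_set G)"
proof -
  note fin = finite_edge_set[OF pair_graph]
  have "(\<Sum>e\<in>edge_set G. Min (layer T ` e)) + card (edges_touching T) + card (edges_touching (ball T)) =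
      (\<Sum>e\<in>edge_set G. Min (layer T ` e) + (if e \<inter> T \<noteq> {} then 1 else 0) +
        (if e \<inter> ball T \<noteq> {} then 1 else 0))"
    using fin by (simp add: edges_touching_def card_eq_sum sum.inter_filter sum.distrib
        del: sum_constant One_nat_def)
  also have "\<dots> = (\<Sum>e\<in>edge_set G. 2)"
  proof (rule sum.cong)
    fix e assume "e \<in> edge_set G"
    then obtain x y where e: "e = {x, y}" by (auto simp: edge_set_def)
    then have Min: "Min (layer T ` e) = min (layer T x) (layer T y)" by simp
    show "Min (layer T ` e) + (if e \<inter> T \<noteq> {} then 1 else 0) + (if e \<inter> ball T \<noteq> {} then 1 else 0) = 2"
      unfolding Min unfolding e by (auto simp: layer_def ball_def)
  qed simp
  finally show ?thesis by simp
qed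

end

text \<open>Diameter at most two is meant: a complete graph satisfies the condition vacuously, so
  both girths fit.\<close>

locale diameter_two = regular_pair_graph +
  assumes diameter: "u \<in> pverts G \<Longrightarrow> v \<in> pverts G \<Longrightarrow> v \<notin> ball {u} \<Longrightarrow> \<exists>x. x \<in> nbrs u \<and> v \<in> nbrs x"
    and degree_pos: "k > 0" and nonempty: "pverts G \<noteq> {}"
begin

lemma distance_to_layer:
  assumes "T \<subseteq> pverts G" "T \<noteq> {}"
  shows "distance_to G T (layer T)"
  unfolding distance_to_def
proof (intro conjI ballI)
  show "layer T s = 0" if "s \<in> T" for s using that by (simp add: layer_def)
  show "case a of (x, y) \<Rightarrow> layer T y \<le> layer T x + 1" if "a \<in> parcs G" for a
    using that by (cases a) (auto simp: layer_def ball_def nbrs_iff)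
  fix y assume y: "y \<in> pverts G - T"
  show "\<exists>x. (x, y) \<in> parcs G \<and> layer T y = layer T x + 1"
  proof (cases "y \<in> ball T")
    case True
    then obtain x where "x \<in> T" "(x, y) \<in> parcs G" using y by (auto simp: ball_def nbrs_iff)
    then show ?thesis using True y by (intro exI[of _ x]) (simp add: layer_def)
  next
    case False
    obtain u where u: "u \<in> T" using assms by auto
    then have "y \<notin> ball {u}" "u \<in> pverts G" using False assms by (auto simp: ball_def)
    then obtain x where x: "x \<in> nbrs u" "y \<in> nbrs x" using diameter y by blast
    \<comment> \<open>If \<open>x\<close> were in \<open>T\<close>, its neighbour \<open>y\<close>
      would lie in \<open>ball T\<close>.\<close>
    then have "x \<in> ball T" "x \<notin> T" using u False by (auto simp: ball_def)
    then show ?thesis using False y x by (intro exI[of _ x]) (simp add: layer_def nbrs_iff)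
  qed
qed

section \<open>Block row sums of the distance matrix\<close>

abbreviation "S \<equiv> subdivision_graph G"

lemma graph_dist_vertex:
  assumes u: "u \<in> pverts G" and x: "x \<in> pverts S"
  shows "graph_dist S (Inl u) x =
    real (case_sum (\<lambda>v. 2 * layer {u} v) (\<lambda>e. 1 + 2 * Min (layer {u} ` e)) x)"
  using u x by (intro graph_dist_eqI distance_to_subdivision_vertex distance_to_layer
      pair_wf_digraph_subdivision_graph pair_graph) (auto simp: pverts_subdivision_graph)

lemma graph_dist_edge:
  assumes e: "e \<in> edge_set G" and x: "x \<in> pverts S"
  shows "graph_dist S (Inr e) x =
    real (case_sum (\<lambda>v. 1 + 2 * layer e v) (\<lambda>e'. if e' = e then 0 else 2 + 2 * Min (layer e ` e')) x)"
proof -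
  have "e \<noteq> {}" using card_edge[OF e] by auto
  then show ?thesis
    using e x edge_subset[OF e]
    by (intro graph_dist_eqI distance_to_subdivision_edge distance_to_layer
        pair_wf_digraph_subdivision_graph pair_graph) (auto simp: pverts_subdivision_graph)
qed

lemma sum_graph_dist_vertex_vertex:
  assumes u: "u \<in> pverts G"
  shows "(\<Sum>v\<in>pverts G. graph_dist S (Inl u) (Inl v)) =
    2 * (2 * real (card (pverts G)) - 1 - real (card (ball {u})))"
proof -
  have "(\<Sum>v\<in>pverts G. graph_dist S (Inl u) (Inl v)) = (\<Sum>v\<in>pverts G. real (2 * layer {u} v))"
    using u by (intro sum.cong) (auto simp: graph_dist_vertex pverts_subdivision_graph)
  also have "\<dots> = 2 * real (\<Sum>v\<in>pverts G. layer {u} v)" by (simp add: sum_distrib_left)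
  finally show ?thesis using arg_cong[OF sum_layer[of "{u}"], of real] u by simp
qed

text \<open>Each edge contributes 1 plus twice its minimal layer; with m edges this is m + 2 (2 m -
  k - t), where t counts the edges touching the ball.\<close>

lemma sum_graph_dist_vertex_edge:
  assumes u: "u \<in> pverts G"
  shows "(\<Sum>f\<in>edge_set G. graph_dist S (Inl u) (Inr f)) =
    5 * real (card (edge_set G)) - 2 * real k - 2 * real (card (edges_touching (ball {u})))"
proof -
  have "(\<Sum>f\<in>edge_set G. graph_dist S (Inl u) (Inr f)) =
      (\<Sum>f\<in>edge_set G. 1 + 2 * real (Min (layer {u} ` f)))"
    using u by (intro sum.cong) (auto simp: graph_dist_vertex pverts_subdivision_graph)
  also have "\<dots> = real (card (edge_set G)) + 2 * real (\<Sum>f\<in>edge_set G. Min (layer {u} ` f))"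
    by (simp add: sum.distrib sum_distrib_left)
  finally show ?thesis
    using arg_cong[OF sum_Min_layer[of "{u}"], of real] card_edges_touching_vertex[OF u] by simp
qed

lemma sum_graph_dist_edge_vertex:
  assumes e: "e \<in> edge_set G"
  shows "(\<Sum>v\<in>pverts G. graph_dist S (Inr e) (Inl v)) =
    5 * real (card (pverts G)) - 4 - 2 * real (card (ball e))"
proof -
  have "(\<Sum>v\<in>pverts G. graph_dist S (Inr e) (Inl v)) = (\<Sum>v\<in>pverts G. 1 + 2 * real (layer e v))"
    using e by (intro sum.cong) (auto simp: graph_dist_edge pverts_subdivision_graph)
  also have "\<dots> = real (card (pverts G)) + 2 * real (\<Sum>v\<in>pverts G. layer e v)"
    by (simp add: sum.distrib sum_distrib_left)
  finally show ?thesis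
    using arg_cong[OF sum_layer[OF edge_subset[OF e]], of real] card_edge[OF e] by simp
qed

lemma sum_graph_dist_edge_edge:
  assumes e: "e \<in> edge_set G"
  shows "(\<Sum>f\<in>edge_set G. graph_dist S (Inr e) (Inr f)) =
    6 * real (card (edge_set G)) - 4 * real k - 2 * real (card (edges_touching (ball e)))"
proof -
  note fin = finite_edge_set[OF pair_graph]
  \<comment> \<open>At f = e the generic term 2 + 2 Min equals 2 while the distance is 0. The
    resulting correction -2 cancels against the 1 in the count 2 k - 1 of edges touching
    \<open>e\<close>.\<close>
  have e0: "Min (layer e ` e) = 0"
  proof -
    have "layer e ` e = {0}" using card_edge[OF e] by (force simp: layer_def card_2_iff)
    then show ?thesis by simp
  qed
  have "(\<Sum>f\<in>edge_set G. graph_dist S (Inr e) (Inr f)) =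
      (\<Sum>f\<in>edge_set G. 2 + 2 * real (Min (layer e ` f)) - (if f = e then 2 else 0))"
    using e e0 by (intro sum.cong) (auto simp: graph_dist_edge pverts_subdivision_graph)
  also have "\<dots> = 2 * real (card (edge_set G)) + 2 * real (\<Sum>f\<in>edge_set G. Min (layer e ` f)) - 2"
    using fin e by (simp add: sum.distrib sum_subtractf sum_distrib_left sum.delta)
  finally show ?thesis using arg_cong[OF sum_Min_layer[of e], of real]
      arg_cong[OF card_edges_touching_edge[OF e], of real] by simp
qed

text \<open>The number of edges is eliminated through 2 m = k n; \<open>b\<close> is given doubled
  because 5 m is 5 k n / 2. It remains to supply the four ball counts.\<close>

lemma distance_spectral_radius_subdivision:
  assumes ord: "vertex_ordering S vs"
    and u: "\<And>u. u \<in> pverts G \<Longrightarrow> card (ball {u}) = p"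
      "\<And>u. u \<in> pverts G \<Longrightarrow> card (edges_touching (ball {u})) = q"
    and e: "\<And>e. e \<in> edge_set G \<Longrightarrow> card (ball e) = r"
      "\<And>e. e \<in> edge_set G \<Longrightarrow> card (edges_touching (ball e)) = s"
    and n: "n = real (card (pverts G))"
    and a: "a = 4 * n - 2 - 2 * real p"
    and b: "2 * b = 5 * real k * n - 4 * real k - 4 * real q"
    and c: "c = 5 * n - 4 - 2 * real r"
    and d: "d = 3 * real k * n - 4 * real k - 2 * real s"
    and pos: "b > 0" "c > 0"
  shows "distance_spectral_radius S vs = 1 / 2 * (a + d + sqrt ((a - d) ^ 2 + 4 * b * c))"
proof -
  have m: "2 * real (card (edge_set G)) = real k * n"
    using card_edge_set unfolding n by (metis of_nat_mult of_nat_numeral)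
  show ?thesis
  proof (rule distance_spectral_radius_equitable[OF ord pverts_subdivision_graph
        pair_finite_verts finite_edge_set[OF pair_graph] nonempty])
    show "graph_dist S x y \<ge> 0" if "x \<in> pverts S" "y \<in> pverts S" for x y
      using that
        by (cases x) (auto simp: graph_dist_vertex graph_dist_edge pverts_subdivision_graph)
    show "(\<Sum>v\<in>pverts G. graph_dist S (Inl x) (Inl v)) = a" if "x \<in> pverts G" for x
      using that n a by (simp add: sum_graph_dist_vertex_vertex u)
    show "(\<Sum>f\<in>edge_set G. graph_dist S (Inl x) (Inr f)) = b" if "x \<in> pverts G" for x
      using that m b by (simp add: sum_graph_dist_vertex_edge u)
    show "(\<Sum>v\<in>pverts G. graph_dist S (Inr x) (Inl v)) = c" if "x \<in> edge_set G" for x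
      using that n c by (simp add: sum_graph_dist_edge_vertex e)
    show "(\<Sum>f\<in>edge_set G. graph_dist S (Inr x) (Inr f)) = d" if "x \<in> edge_set G" for x
      using that m d by (simp add: sum_graph_dist_edge_edge e)
  qed (use pos in auto)
qed

end

section \<open>Moore graphs of girth three and five\<close>

lemma girth_le:
  assumes "girth G = enat g" "pre_digraph.cycle (with_proj G) p" "3 \<le> length p"
  shows "g \<le> length p"
proof -
  have "girth G \<le> enat (length p)" unfolding girth_def using assms by (intro INF_lower) auto
  then show ?thesis using assms(1) by simp
qed

lemma girth_finite_imp_cycle:
  assumes "girth G = enat g"
  obtains p where "pre_digraph.cycle (with_proj G) p"
proof -
  have "{p. pre_digraph.cycle (with_proj G) p \<and> 3 \<le> length p} \<noteq> {}"
    using assms unfolding girth_def by (metis INF_empty enat.distinct(1) top_enat_def)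
  then show ?thesis using that by blast
qed

lemma (in pair_graph) cycle_3:
  assumes "(x, y) \<in> parcs G" "(y, z) \<in> parcs G" "(z, x) \<in> parcs G"
  shows "cycle [(x, y), (y, z), (z, x)]"
  using assms in_arcsD1 no_loops'
  by (auto simp: cycle_def awalk_Cons_iff awalk_Nil_iff intro!: exI[of _ x])

text \<open>Consecutive vertices differ since there are no loops; the two inequalities separate the
  opposite ones.\<close>

lemma (in pair_graph) cycle_4:
  assumes "(x, y) \<in> parcs G" "(y, z) \<in> parcs G" "(z, w) \<in> parcs G" "(w, x) \<in> parcs G" "x \<noteq> z" "y \<noteq> w"
  shows "cycle [(x, y), (y, z), (z, w), (w, x)]"
  using assms in_arcsD1 no_loops'
  by (auto simp: cycle_def awalk_Cons_iff awalk_Nil_iff intro!: exI[of _ x])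

lemma moore_bound_3: "moore_bound k 3 = 1 + k"
  by (simp add: moore_bound_def)

lemma moore_bound_5: "moore_bound k 5 = 1 + k + k * (k - 1)"
proof -
  have "(\<Sum>i<2. k * (k - 1) ^ i) = k + k * (k - 1)" by (simp add: numeral_2_eq_2)
  then show ?thesis by (simp add: moore_bound_def)
qed

lemma minimal_cage_imp_regular_pair_graph:
  assumes "minimal_cage k g G"
  shows "regular_pair_graph G k"
proof -
  have "pair_graph G" "regular k G"
    using assms
      by (auto simp: minimal_cage_def cage_def regular_girth_graph_def connected_graph_def)
  then interpret pair_graph G by simp
  show ?thesis by unfold_locales fact
qed

text \<open>Finite girth yields a cycle, hence an arc, hence a vertex with a neighbour.\<close>

lemma minimal_cage_degree_pos:
  assumes "minimal_cage k g G"
  shows "k > 0"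
proof -
  interpret regular_pair_graph G k using minimal_cage_imp_regular_pair_graph[OF assms] .
  have "girth G = enat g" using assms
    by (auto simp: minimal_cage_def cage_def regular_girth_graph_def)
  then obtain p where "cycle p" by (rule girth_finite_imp_cycle)
  then obtain x y where "(x, y) \<in> parcs G"
    by (cases p) (auto simp: cycle_def awalk_Cons_iff)
  then have "y \<in> nbrs x" "x \<in> pverts G" using in_arcsD1 by (auto simp: nbrs_iff)
  then show ?thesis using card_nbrs[of x] finite_nbrs[of x] by (auto simp: card_gt_0_iff)
qed

context regular_pair_graph
begin

lemma card_ball_vertex:
  assumes "u \<in> pverts G"
  shows "card (ball {u}) = k + 1"
proof -
  have "ball {u} = insert u (nbrs u)" by (auto simp: ball_def)
  then show ?thesis using card_nbrs[OF assms] finite_nbrs not_in_nbrs by simp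
qed

text \<open>Every ball of radius one has k + 1 elements and so is the whole vertex set. Thus all
  edges touch it, which makes all four ball counts constant.\<close>

lemma complete_distance_spectral_radius_subdivision:
  assumes n: "card (pverts G) = k + 1" and k: "k > 0"
    and ord: "vertex_ordering (subdivision_graph G) vs"
  shows "distance_spectral_radius (subdivision_graph G) vs =
    1 / 2 * (2 * real k ^ 2 + sqrt (2 * real k * (2 * real k + 1) * (real k ^ 2 + 1)))"
proof -
  have ball: "ball {u} = pverts G" if "u \<in> pverts G" for u
    using that ball_subset[of "{u}"] card_ball_vertex n pair_finite_verts
    by (intro card_subset_eq) auto
  have ball_edge: "ball e = pverts G" if e: "e \<in> edge_set G" for e
  proof -
    obtain u where "u \<in> e" using card_edge[OF e] by fastforce
    then have "ball {u} \<subseteq> ball e" "u \<in> pverts G" using edge_subset[OF e] by (auto simp: ball_def)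
    then show ?thesis using ball ball_subset[OF edge_subset[OF e]] by blast
  qed
  interpret diameter_two G k
  proof
    show "pverts G \<noteq> {}" using n by auto
  qed (use ball k in auto)
  have m: "2 * real (card (edge_set G)) = real k * (real k + 1)"
    using arg_cong[OF card_edge_set, of real] n by (simp add: algebra_simps)
  define x where "x = real k"
  have x: "x \<ge> 1" using k by (simp add: x_def)
  have "distance_spectral_radius S vs = 1 / 2 * (2 * x + (2 * x ^ 2 - 2 * x) +
      sqrt ((2 * x - (2 * x ^ 2 - 2 * x)) ^ 2 + 4 * (x * (3 * x - 1) / 2) * (3 * x - 1)))"
  proof (rule distance_spectral_radius_subdivision[OF ord,
        where n = "x + 1" and p = "k + 1" and r = "k + 1"
        and q = "card (edge_set G)" and s = "card (edge_set G)"])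
    show "2 * (x * (3 * x - 1) / 2) = 5 * real k * (x + 1) - 4 * real k - 4 * real (card (edge_set G))"
      using m by (simp add: x_def[symmetric] field_simps)
    show "2 * x ^ 2 - 2 * x = 3 * real k * (x + 1) - 4 * real k - 2 * real (card (edge_set G))"
      using m by (simp add: x_def[symmetric] algebra_simps power2_eq_square)
    show "0 < x * (3 * x - 1) / 2" using x by simp
  qed (use ball ball_edge edges_touching_pverts n x in \<open>auto simp: x_def\<close>)
  \<comment> \<open>The discriminant (a - d)^2 + 4 b c of the quotient matrix, in factored
    form.\<close>
  also have "(2 * x - (2 * x ^ 2 - 2 * x)) ^ 2 + 4 * (x * (3 * x - 1) / 2) * (3 * x - 1) =
      2 * x * (2 * x + 1) * (x ^ 2 + 1)"
    by (simp add: power2_eq_square field_simps)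
  finally show ?thesis by (simp add: x_def)
qed

text \<open>Without triangles and 4-cycles the breadth-first tree of depth two from \<open>u\<close>
  has no coincidences, so its 1 + k + k (k - 1) vertices exhaust the graph.\<close>

lemma Moore_diameter_two:
  assumes triangle_free: "\<And>x y z. \<lbrakk>(x, y) \<in> parcs G; (y, z) \<in> parcs G; (z, x) \<in> parcs G\<rbrakk> \<Longrightarrow> False"
    and C4_free: "\<And>x y z w. \<lbrakk>(x, y) \<in> parcs G; (y, z) \<in> parcs G; (z, w) \<in> parcs G; (w, x) \<in> parcs G\<rbrakk>
        \<Longrightarrow> x = z \<or> y = w"
    and n: "card (pverts G) = 1 + k + k * (k - 1)" and u: "u \<in> pverts G"
  shows "pverts G = ball {u} \<union> (\<Union>x\<in>nbrs u. nbrs x - {u})"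
proof -
  define N2 where "N2 = (\<Union>x\<in>nbrs u. nbrs x - {u})"
  have "card (nbrs x - {u}) = k - 1" if "x \<in> nbrs u" for x
  proof -
    have "u \<in> nbrs x" "x \<in> pverts G" using that nbrs_sym nbrs_subset by auto
    then show ?thesis using card_nbrs by (simp add: card_Diff_singleton)
  qed
  \<comment> \<open>A second common neighbour of \<open>x\<close> and \<open>y\<close> besides
    \<open>u\<close> would close a 4-cycle.\<close>
  moreover have "(nbrs x - {u}) \<inter> (nbrs y - {u}) = {}" if "x \<in> nbrs u" "y \<in> nbrs u" "x \<noteq> y" for x y
    using that C4_free[of u x _ y] arcs_symmetric by (auto simp: nbrs_iff)
  ultimately have "card N2 = k * (k - 1)"
    unfolding N2_def using finite_nbrs card_nbrs[OF u] by (subst card_UN_disjoint) auto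
  moreover have "ball {u} \<inter> N2 = {}"
    using triangle_free arcs_symmetric unfolding ball_def N2_def nbrs_def by blast
  moreover have "finite N2" "finite (ball {u})"
    using finite_nbrs by (auto simp: N2_def ball_def)
  ultimately have "card (ball {u} \<union> N2) = card (pverts G)"
    using card_ball_vertex[OF u] n by (simp add: card_Un_disjoint)
  moreover have "ball {u} \<union> N2 \<subseteq> pverts G"
    using u ball_subset[of "{u}"] nbrs_subset by (auto simp: N2_def)
  ultimately show ?thesis
    unfolding N2_def using pair_finite_verts by (metis card_subset_eq)
qed

text \<open>The ball of a vertex spans a star with \<open>k\<close> edges and the ball of an edge a
  double star with 2 k - 1 edges; this determines the numbers of edges touching them.\<close>

lemma Moore_distance_spectral_radius_subdivision:
  assumes triangle_free: "\<And>x y z. \<lbrakk>(x, y) \<in> parcs G; (y, z) \<in> parcs G; (z, x) \<in> parcs G\<rbrakk> \<Longrightarrow> False"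
    and C4_free: "\<And>x y z w. \<lbrakk>(x, y) \<in> parcs G; (y, z) \<in> parcs G; (z, w) \<in> parcs G; (w, x) \<in> parcs G\<rbrakk>
        \<Longrightarrow> x = z \<or> y = w"
    and n: "card (pverts G) = 1 + k + k * (k - 1)" and k: "k > 0"
    and ord: "vertex_ordering (subdivision_graph G) vs"
  shows "distance_spectral_radius (subdivision_graph G) vs =
    1 / 2 * ((3 * real k ^ 3 + real k - 2)
      + sqrt (9 * real k ^ 6 + 2 * real k ^ 5 + 14 * real k ^ 4 - 40 * real k ^ 3
              + 41 * real k ^ 2 - 18 * real k + 4))"
proof -
  interpret diameter_two G k
  proof
    show "pverts G \<noteq> {}" using n by auto
    show "\<exists>x. x \<in> nbrs u \<and> v \<in> nbrs x" if "u \<in> pverts G" "v \<in> pverts G" "v \<notin> ball {u}" for u v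
      using Moore_diameter_two[OF triangle_free C4_free n that(1)] that by auto
  qed (use k in auto)
  have touching_vertex: "card (edges_touching (ball {u})) = k * k" if u: "u \<in> pverts G" for u
  proof -
    have "edges_within (ball {u}) = {e \<in> edge_set G. u \<in> e}"
    proof (intro equalityI subsetI)
      fix e assume e: "e \<in> edges_within (ball {u})"
      then obtain x y where xy: "e = {x, y}" "(x, y) \<in> parcs G"
        by (auto simp: edges_within_def edge_set_def)
      then show "e \<in> {e \<in> edge_set G. u \<in> e}"
        using e triangle_free[of u x y] arcs_symmetric
          by (auto simp: edges_within_def ball_def nbrs_iff)
    next
      fix e assume e: "e \<in> {e \<in> edge_set G. u \<in> e}"
      then obtain x where "e = {u, x}" "(u, x) \<in> parcs G"
        by (auto elim: edge_setE[OF pair_graph, of e u])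
      then show "e \<in> edges_within (ball {u})" using e
        by (auto simp: edges_within_def ball_def nbrs_iff)
    qed
    then have "card (edges_within (ball {u})) = k" using card_incident_edges[OF u] by simp
    then show ?thesis
      using edges_touching_within[of "ball {u}"] ball_subset[of "{u}"] card_ball_vertex[OF u] u by simp
  qed
  have edge: "card (ball e) = 2 * k" "card (edges_touching (ball e)) + (2 * k - 1) = 2 * k * k"
    if e: "e \<in> edge_set G" for e
  proof -
    obtain a b where ab: "e = {a, b}" "(a, b) \<in> parcs G" using e by (auto simp: edge_set_def)
    then have verts: "a \<in> pverts G" "b \<in> pverts G" using in_arcsD1 in_arcsD2 by auto
    have ball: "ball e = nbrs a \<union> nbrs b" using ab arcs_symmetric by (auto simp: ball_def nbrs_iff)
    have "nbrs a \<inter> nbrs b = {}"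
      using triangle_free ab(2) arcs_symmetric unfolding nbrs_def by blast
    then show card_ball: "card (ball e) = 2 * k"
      unfolding ball using card_nbrs verts finite_nbrs by (simp add: card_Un_disjoint)
    define I where "I v = {f \<in> edge_set G. v \<in> f}" for v
    have "edges_within (ball e) = I a \<union> I b"
    proof (intro equalityI subsetI)
      fix f assume f: "f \<in> edges_within (ball e)"
      then obtain x y where xy: "f = {x, y}" "(x, y) \<in> parcs G" "(y, x) \<in> parcs G"
        using arcs_symmetric by (auto simp: edges_within_def edge_set_def)
      \<comment> \<open>Otherwise both ends of \<open>f\<close> are neighbours of the same end of
        \<open>e\<close>, giving a triangle, or of different ends, giving a 4-cycle.\<close>
      have "a \<in> f \<or> b \<in> f"
        using f ball xy ab triangle_free[of a x y] triangle_free[of b x y]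
          C4_free[of a x y b] C4_free[of a y x b] arcs_symmetric
        by (auto simp: edges_within_def nbrs_iff)
      then show "f \<in> I a \<union> I b" using f by (auto simp: I_def edges_within_def)
    next
      fix f assume "f \<in> I a \<union> I b"
      then show "f \<in> edges_within (ball e)"
        using ab
        by (auto simp: edges_within_def I_def ball_def nbrs_iff edge_set_iff[OF pair_graph]
            elim!: edge_setE[OF pair_graph])
    qed
    \<comment> \<open>The shared edge \<open>e\<close> accounts for the 1 in 2 k - 1 by
      inclusion-exclusion.\<close>
    moreover have "I a \<inter> I b = {e}"
    proof (intro equalityI subsetI)
      fix f assume f: "f \<in> I a \<inter> I b"
      then obtain x y where "f = {x, y}" by (auto simp: I_def edge_set_def)
      then show "f \<in> {e}" using f ab no_loops'[OF ab(2)] by (auto simp: I_def)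
    qed (use e ab in \<open>auto simp: I_def\<close>)
    moreover have "card (I a) = k" "card (I b) = k" "finite (I a)" "finite (I b)"
      using card_incident_edges verts finite_edge_set[OF pair_graph] by (auto simp: I_def)
    ultimately have "card (edges_within (ball e)) + 1 = 2 * k"
      using card_Un_Int[of "I a" "I b"] by simp
    then show "card (edges_touching (ball e)) + (2 * k - 1) = 2 * k * k"
      using edges_touching_within[OF ball_subset[OF edge_subset[OF e]]] card_ball by simp
  qed
  define x where "x = real k"
  have x: "x \<ge> 1" using k by (simp add: x_def)
  have n': "real (card (pverts G)) = x ^ 2 + 1"
    using n k by (simp add: x_def of_nat_diff power2_eq_square algebra_simps)
  have touching_edge: "card (edges_touching (ball e)) = 2 * k * k - (2 * k - 1)"
    if "e \<in> edge_set G" for e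
    using edge(2)[OF that] by simp
  \<comment> \<open>Makes the natural-number subtraction in the count \<open>s\<close> genuine
    before passing to the reals.\<close>
  have le: "2 * k - 1 \<le> 2 * k * k" using le_square[of k] by linarith
  have s: "real (2 * k * k - (2 * k - 1)) = 2 * x ^ 2 - 2 * x + 1"
  proof -
    have "real (2 * k - 1) = 2 * x - 1" using k by (subst of_nat_diff) (auto simp: x_def)
    then show ?thesis unfolding of_nat_diff[OF le] by (simp add: x_def power2_eq_square)
  qed
  \<comment> \<open>This is the row sum \<open>c\<close>; as a sum of squares it is visibly
    positive.\<close>
  have sq: "(5 * x ^ 2 - 4 * x + 1) = (2 * x - 1) ^ 2 + x ^ 2"
    by (simp add: power2_eq_square algebra_simps)
  have c: "0 < 5 * x ^ 2 - 4 * x + 1"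
    unfolding sq using x by (intro add_nonneg_pos) auto
  have "distance_spectral_radius S vs = 1 / 2 * (4 * x ^ 2 - 2 * x + (3 * x ^ 3 - 4 * x ^ 2 + 3 * x - 2) +
      sqrt ((4 * x ^ 2 - 2 * x - (3 * x ^ 3 - 4 * x ^ 2 + 3 * x - 2)) ^ 2 +
        4 * (x * (5 * x ^ 2 - 4 * x + 1) / 2) * (5 * x ^ 2 - 4 * x + 1)))"
  proof (rule distance_spectral_radius_subdivision[OF ord,
        where n = "x ^ 2 + 1" and p = "k + 1" and r = "2 * k"
        and q = "k * k" and s = "2 * k * k - (2 * k - 1)"])
    show "x ^ 2 + 1 = real (card (pverts G))" using n' by simp
    show "3 * x ^ 3 - 4 * x ^ 2 + 3 * x - 2 =
        3 * real k * (x ^ 2 + 1) - 4 * real k - 2 * real (2 * k * k - (2 * k - 1))"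
      unfolding s x_def[symmetric] by (simp add: algebra_simps power2_eq_square power3_eq_cube)
    show "2 * (x * (5 * x ^ 2 - 4 * x + 1) / 2) = 5 * real k * (x ^ 2 + 1) - 4 * real k - 4 * real (k * k)"
      by (simp add: x_def power2_eq_square field_simps)
    show "0 < x * (5 * x ^ 2 - 4 * x + 1) / 2" using x c by simp
    show "0 < 5 * x ^ 2 - 4 * x + 1" by (rule c)
  qed (use card_ball_vertex touching_vertex edge(1) touching_edge in
      \<open>auto simp: x_def power2_eq_square algebra_simps\<close>)
  also have "(4 * x ^ 2 - 2 * x - (3 * x ^ 3 - 4 * x ^ 2 + 3 * x - 2)) ^ 2 +
        4 * (x * (5 * x ^ 2 - 4 * x + 1) / 2) * (5 * x ^ 2 - 4 * x + 1) =
      9 * x ^ 6 + 2 * x ^ 5 + 14 * x ^ 4 - 40 * x ^ 3 + 41 * x ^ 2 - 18 * x + 4"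
    by (simp add: eval_nat_numeral field_simps)
  finally show ?thesis by (simp add: x_def)
qed

end

theorem theorem3p3:
  fixes G :: "'a pair_pre_digraph" and k g :: nat and vs :: "('a + 'a set) list"
  assumes "g \<in> {3, 5}"
    and "minimal_cage k g G"
    and "vertex_ordering (subdivision_graph G) vs"
  shows "distance_spectral_radius (subdivision_graph G) vs =
    (if g = 3 then
       1 / 2 * (2 * real k ^ 2 + sqrt (2 * real k * (2 * real k + 1) * (real k ^ 2 + 1)))
     else
       1 / 2 * ((3 * real k ^ 3 + real k - 2)
         + sqrt (9 * real k ^ 6 + 2 * real k ^ 5 + 14 * real k ^ 4 - 40 * real k ^ 3
                 + 41 * real k ^ 2 - 18 * real k + 4)))"
proof -
  interpret regular_pair_graph G k using minimal_cage_imp_regular_pair_graph[OF assms(2)] .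
  note k = minimal_cage_degree_pos[OF assms(2)]
  have n: "card (pverts G) = moore_bound k g" and girth: "girth G = enat g"
    using assms(2) by (auto simp: minimal_cage_def cage_def regular_girth_graph_def)
  show ?thesis
  proof (cases "g = 3")
    case True
    then show ?thesis
      using complete_distance_spectral_radius_subdivision[OF _ k assms(3)] n
        by (simp add: moore_bound_3)
  next
    case False
    then have g: "g = 5" using assms(1) by simp
    \<comment> \<open>Girth five enters only through the absence of cycles of length three and
      four.\<close>
    have "False" if "(x, y) \<in> parcs G" "(y, z) \<in> parcs G" "(z, x) \<in> parcs G" for x y z
      using girth_le[OF girth cycle_3[OF that]] g by simp
    moreover have "x = z \<or> y = w"
      if "(x, y) \<in> parcs G" "(y, z) \<in> parcs G" "(z, w) \<in> parcs G" "(w, x) \<in> parcs G" for x y z w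
      using girth_le[OF girth cycle_4[OF that]] g by auto
    moreover have "card (pverts G) = 1 + k + k * (k - 1)" using n g by (simp add: moore_bound_5)
    ultimately show ?thesis
      using Moore_distance_spectral_radius_subdivision[OF _ _ _ k assms(3)] False by auto
  qed
qed

end
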